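(* Let $G=(V,E)$ be a strongly connected digraph with $d_w\ge2$ for all $w\in V$. Consider a GD-IFS on $\mathbb{R}$ based on $G$ satisfying the COSC, with attractors $(F_u)_{u\in V}$, absolute contraction ratio set $A=\{|\rho_e|:e\in E\}$, basic gap lengths $\lambda_w^{(k)}$ ($w\in V$, $1\le k\le d_w-1$) and sets $\Lambda_w$ of positive basic gap lengths. Suppose that: $(i')$ all the contraction ratios $\rho_e$ ($e\in E$) have different absolute values, and $1\notin A^{\mathbb{Q}^*}$; $(ii')$ $\Lambda_w\neq\emptyset$ for all $w\in V$; $(iii)$ for all pairs $(w,k)\ne(z,m)$ with $w,z\in V$, $1\le k\le d_w-1$, $1\le m\le d_z-1$ and $\lambda_z^{(m)}\neq0$, one has $\lambda_w^{(k)}/\lambda_z^{(m)}\notin A^{\mathbb{Q}}$. If $G$ contains a directed circuit not passing through a vertex $u$, then $F_u$ is not the attractor of any standard IFS on $\mathbb{R}$ satisfying the COSC.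
   Context: **Digraphs.** A digraph $G=(V,E)$ has finitely many vertices and directed edges (loops and multiple edges allowed). $E_{uv}$ is the set of edges from $u$ to $v$, $\omega(e)$ is the terminal vertex of the edge $e$, and $d_u$ is the number of edges leaving $u$. A directed path is a finite sequence $e_1\cdots e_k$ ($k\ge1$) of edges with the terminal vertex of $e_i$ equal to the initial vertex of $e_{i+1}$; a directed circuit is a directed path whose initial and terminal vertices coincide. $G$ is strongly connected if for all $u,v\in V$ (including $u=v$) there is a directed path from $u$ to $v$. **GD-IFS.** A GD-IFS on $\mathbb{R}$ based on $G$ is a family $(S_e)_{e\in E}$ of contracting similarities of $\mathbb{R}$ with contraction ratios $\rho_e\in(-1,1)\setminus\{0\}$, $S_e(t)=\rho_et+c_e$. Its attractors are the unique nonempty compact sets $(F_u)_{u\in V}$ with $F_u=\bigcup_{v\in V}\bigcup_{e\in E_{uv}}S_e(F_v)$ for all $u\in V$. It satisfies the COSC (convex open set condition) if there are nonempty bounded convex open sets $(U_u)_{u\in V}$ with $\bigcup_{v\in V}\bigcup_{e\in E_{uv}}S_e(U_v)\subset U_u$, the union being disjoint, for each $u\in V$; one can then take $U_u=\mathrm{int}(\mathrm{conv}\,F_u)$. **Standard IFS.** A standard IFS on $\mathbb{R}$ is a finite set of distinct contracting similarities $\{S_i\}$ of $\mathbb{R}$ (ratios in $(-1,1)\setminus\{0\}$); its attractor is the unique nonempty compact $K$ with $K=\bigcup_i S_i(K)$. It satisfies the COSC if there is a nonempty convex open set $U$ with $\bigcup_i S_i(U)\subseteq U$, the union being disjoint (equivalently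 one can take $U=\mathrm{int}(\mathrm{conv}\,K)$). **Basic gaps.** For a COSC GD-IFS and $u\in V$, the intervals $S_e(\mathrm{conv}\,F_{\omega(e)})$, $e$ leaving $u$, have disjoint interiors; rank them from left to right. For $1\le k\le d_u-1$, $\lambda_u^{(k)}\ge0$ is the length of the (possibly empty) complementary open interval between the $k$th and $(k+1)$th of them, and $\Lambda_u=\{\lambda_u^{(k)}:\lambda_u^{(k)}>0,\ 1\le k\le d_u-1\}$. **Power sets.** For a finite set $A=\{a_1,\dots,a_n\}\subset(0,\infty)$ (distinct $a_i$), $A^{\mathbb{Q}^*}$ is the set of all products $\prod_{i=1}^n a_i^{m_i}$ with $(m_i)$ a non-zero vector of rationals, and $A^{\mathbb{Q}}=\{1\}\cup A^{\mathbb{Q}^*}$. *)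

theory Defs
  imports "HOL-Analysis.Analysis" "Graph_Theory.Arc_Walk"
begin

section \<open>Digraphs\<close>

text \<open>
  The locale \<^locale>\<open>fin_digraph\<close> allows loops and multiple arcs.  The initial and terminal vertex
  of an arc \<open>e\<close> are \<open>tail G e\<close> and \<open>head G e\<close>.  Unlike walks, directed paths are nonempty.
\<close>

definition directed_path :: "('v, 'e) pre_digraph \<Rightarrow> 'v \<Rightarrow> 'e list \<Rightarrow> 'v \<Rightarrow> bool" where
  "directed_path G u p v \<longleftrightarrow> pre_digraph.awalk G u p v \<and> p \<noteq> []"

text \<open>
  The case \<open>u = v\<close> is not automatic, in contrast to the strong connectivity of the entry
  \<open>Graph_Theory\<close>, which is based on reflexive reachability.
\<close>

definition strongly_conn :: "('v, 'e) pre_digraph \<Rightarrow> bool" where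
  "strongly_conn G \<longleftrightarrow> (\<forall>u\<in>verts G. \<forall>v\<in>verts G. \<exists>p. directed_path G u p v)"

definition circuit_avoiding :: "('v, 'e) pre_digraph \<Rightarrow> 'v \<Rightarrow> bool" where
  "circuit_avoiding G u \<longleftrightarrow>
     (\<exists>v p. directed_path G v p v \<and> u \<notin> set (pre_digraph.awalk_verts G v p))"

section \<open>Graph-directed iterated function systems on the line\<close>

text \<open>
  The similarity of an arc \<open>e\<close> is \<open>t \<mapsto> \<rho> e * t + c e\<close>; only the ratios are constrained.
\<close>

locale gd_ifs = fin_digraph G
  for G :: "('v, 'e) pre_digraph" +
  fixes \<rho> :: "'e \<Rightarrow> real"
  assumes ratio: "e \<in> arcs G \<Longrightarrow> \<rho> e \<in> {-1<..<1} - {0}"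

definition gd_map :: "('e \<Rightarrow> real) \<Rightarrow> ('e \<Rightarrow> real) \<Rightarrow> 'e \<Rightarrow> real \<Rightarrow> real" where
  "gd_map \<rho> c e t = \<rho> e * t + c e"

definition gd_attractors ::
    "('v, 'e) pre_digraph \<Rightarrow> ('e \<Rightarrow> real) \<Rightarrow> ('e \<Rightarrow> real) \<Rightarrow> ('v \<Rightarrow> real set) \<Rightarrow> bool" where
  "gd_attractors G \<rho> c F \<longleftrightarrow>
     (\<forall>u\<in>verts G. F u \<noteq> {} \<and> compact (F u) \<and>
        F u = (\<Union>e\<in>out_arcs G u. gd_map \<rho> c e ` F (head G e)))"

definition gd_cosc :: "('v, 'e) pre_digraph \<Rightarrow> ('e \<Rightarrow> real) \<Rightarrow> ('e \<Rightarrow> real) \<Rightarrow> bool" where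
  "gd_cosc G \<rho> c \<longleftrightarrow>
     (\<exists>U. \<forall>u\<in>verts G. U u \<noteq> {} \<and> bounded (U u) \<and> convex (U u) \<and> open (U u) \<and>
        (\<Union>e\<in>out_arcs G u. gd_map \<rho> c e ` U (head G e)) \<subseteq> U u \<and>
        disjoint_family_on (\<lambda>e. gd_map \<rho> c e ` U (head G e)) (out_arcs G u))"

definition abs_ratios :: "('v, 'e) pre_digraph \<Rightarrow> ('e \<Rightarrow> real) \<Rightarrow> real set" where
  "abs_ratios G \<rho> = (\<lambda>e. \<bar>\<rho> e\<bar>) ` arcs G"

section \<open>Basic gaps\<close>

definition basic_interval ::
    "('v, 'e) pre_digraph \<Rightarrow> ('e \<Rightarrow> real) \<Rightarrow> ('e \<Rightarrow> real) \<Rightarrow> ('v \<Rightarrow> real set) \<Rightarrow> 'e \<Rightarrow> real set" where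
  "basic_interval G \<rho> c F e = gd_map \<rho> c e ` (convex hull F (head G e))"

text \<open>
  The arcs leaving a vertex, listed by increasing left endpoint of their basic intervals.  If every
  vertex of a strongly connected digraph has out-degree at least two and the COSC holds, these
  intervals are nondegenerate with disjoint interiors, so the left endpoints are distinct and this
  is the left-to-right order.
\<close>

definition ranked_arcs ::
    "('v, 'e) pre_digraph \<Rightarrow> ('e \<Rightarrow> real) \<Rightarrow> ('e \<Rightarrow> real) \<Rightarrow> ('v \<Rightarrow> real set) \<Rightarrow> 'v \<Rightarrow> 'e list" where
  "ranked_arcs G \<rho> c F u =
     sorted_key_list_of_set (\<lambda>e. Inf (basic_interval G \<rho> c F e)) (out_arcs G u)"

text \<open>
  The gap number \<open>k\<close>, for \<open>1 \<le> k \<le> out_degree G u - 1\<close>, lies between the \<open>k\<close>th and the \<open>(k+1)\<close>th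
  interval; lists are indexed from \<open>0\<close>, whence the shift.
\<close>

definition basic_gap ::
    "('v, 'e) pre_digraph \<Rightarrow> ('e \<Rightarrow> real) \<Rightarrow> ('e \<Rightarrow> real) \<Rightarrow> ('v \<Rightarrow> real set) \<Rightarrow> 'v \<Rightarrow> nat \<Rightarrow> real" where
  "basic_gap G \<rho> c F u k =
     Inf (basic_interval G \<rho> c F (ranked_arcs G \<rho> c F u ! k)) -
     Sup (basic_interval G \<rho> c F (ranked_arcs G \<rho> c F u ! (k - 1)))"

definition gap_set ::
    "('v, 'e) pre_digraph \<Rightarrow> ('e \<Rightarrow> real) \<Rightarrow> ('e \<Rightarrow> real) \<Rightarrow> ('v \<Rightarrow> real set) \<Rightarrow> 'v \<Rightarrow> real set" where
  "gap_set G \<rho> c F u =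
     {basic_gap G \<rho> c F u k |k. basic_gap G \<rho> c F u k > 0 \<and> k \<in> {1..out_degree G u - 1}}"

section \<open>Rational power sets\<close>

definition rat_powers_star :: "real set \<Rightarrow> real set" where
  "rat_powers_star A = {\<Prod>a\<in>A. a powr of_rat (m a) |m :: real \<Rightarrow> rat. \<exists>a\<in>A. m a \<noteq> 0}"

definition rat_powers :: "real set \<Rightarrow> real set" where
  "rat_powers A = {1} \<union> rat_powers_star A"

section \<open>Standard iterated function systems on the line\<close>

text \<open>A standard IFS is a set of maps, so its members are distinct.\<close>

definition standard_ifs :: "(real \<Rightarrow> real) set \<Rightarrow> bool" where
  "standard_ifs I \<longleftrightarrow>
     finite I \<and> (\<forall>f\<in>I. \<exists>r s. r \<in> {-1<..<1} - {0} \<and> f = (\<lambda>t. r * t + s))"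

definition ifs_attractor :: "(real \<Rightarrow> real) set \<Rightarrow> real set \<Rightarrow> bool" where
  "ifs_attractor I K \<longleftrightarrow> K \<noteq> {} \<and> compact K \<and> K = (\<Union>f\<in>I. f ` K)"

definition ifs_cosc :: "(real \<Rightarrow> real) set \<Rightarrow> bool" where
  "ifs_cosc I \<longleftrightarrow>
     (\<exists>U. U \<noteq> {} \<and> convex U \<and> open U \<and> (\<Union>f\<in>I. f ` U) \<subseteq> U \<and> disjoint_family_on (\<lambda>f. f ` U) I)"

end

theory Submission
  imports Defs
begin

text \<open>
  The lengths of the gaps of \<open>F u\<close>, that is of its bounded complementary intervals, are described in
  two ways, and counting contradicts the coexistence of the two descriptions.

  By the COSC the maps of a system carry gaps to gaps, and every gap is either basic or the image of
  a gap (\<open>gap_length_image\<close>, \<open>gap_length_cases\<close>).  Hence the gap lengths of \<open>F u\<close> are the products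
  \<open>\<bar>\<rho>\<^sub>p\<bar> * \<lambda>\<close>, where \<open>p\<close> is a walk from \<open>u\<close> to some vertex \<open>z\<close>, the factor \<open>\<bar>\<rho>\<^sub>p\<bar>\<close> is its weight and \<open>\<lambda>\<close> is
  a positive basic gap length at \<open>z\<close>.  The independence hypotheses on gaps and ratios say that such
  a product determines the basic gap and the multiplicity of every arc in \<open>p\<close>
  (\<open>gap_representation_unique\<close>); in particular it determines how often \<open>p\<close> leaves \<open>u\<close>.

  Suppose that \<open>F u\<close> is also the attractor of a standard system with the COSC, and let \<open>r\<close> be the
  absolute ratio of one of its maps.  Multiplication by \<open>r\<close> maps gap lengths to gap lengths.
  By the pigeonhole principle two of the lengths \<open>r\<^sup>n * \<lambda>\<close>, for a basic gap length \<open>\<lambda>\<close> at \<open>u\<close>, come from the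
  same basic gap, so \<open>r\<close> is a monomial with rational exponents in the ratios \<open>\<bar>\<rho> e\<bar>\<close>.  Independence
  then shows that \<open>r * \<lambda>\<close> is a copy of \<open>\<lambda>\<close> itself: \<open>r\<close> is the weight of a nonempty closed walk at \<open>u\<close>
  (\<open>self_similarity_ratio_is_closed_walk_weight\<close>).  So every map of the standard system that is
  applied to a gap adds at least one departure from \<open>u\<close>.  Since the standard system has only finitely
  many basic gaps, only finitely many gap lengths have a given number of departures
  (\<open>finite_gap_lengths_bounded_departures\<close>).  But a circuit that avoids \<open>u\<close> can be repeated without
  departing from \<open>u\<close>, which yields infinitely many
  (\<open>infinite_gap_lengths_bounded_departures\<close>).
\<close>

section \<open>Gaps of compact sets of reals\<close>

text \<open>
  The interpretation of \<^locale>\<open>folding_insort_key\<close> takes place inside the class, where its facts are about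
  the class constant \<^const>\<open>sorted_key_list_of_set\<close>; instantiated directly at a concrete type they are not.
\<close>

context linorder
begin

lemma sorted_key_list_of_set_inj:
  fixes f :: "'b \<Rightarrow> 'a"
  assumes "inj_on f A" "finite A"
  shows "set (sorted_key_list_of_set f A) = A"
    and "length (sorted_key_list_of_set f A) = card A"
    and "sorted_wrt (<) (map f (sorted_key_list_of_set f A))"
proof -
  interpret folding_insort_key "(\<le>)" "(<)" A f
    by unfold_locales (rule assms)
  show "set (sorted_key_list_of_set f A) = A"
    "length (sorted_key_list_of_set f A) = card A"
    "sorted_wrt (<) (map f (sorted_key_list_of_set f A))"
    using assms(2) by simp_all
qed

end

definition is_gap :: "real set \<Rightarrow> real \<Rightarrow> real \<Rightarrow> bool" where
  "is_gap K a b \<longleftrightarrow> a \<in> K \<and> b \<in> K \<and> a < b \<and> K \<inter> {a<..<b} = {}"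

definition gap_lengths :: "real set \<Rightarrow> real set" where
  "gap_lengths K = {b - a |a b. is_gap K a b}"

lemma gap_lengthsI: "is_gap K a b \<Longrightarrow> b - a \<in> gap_lengths K"
  by (auto simp: gap_lengths_def)

lemma gap_length_pos: "l \<in> gap_lengths K \<Longrightarrow> l > 0"
  by (auto simp: gap_lengths_def is_gap_def)

lemma Inf_convex_hull:
  fixes K :: "real set"
  assumes "compact K" "K \<noteq> {}"
  shows "Inf (convex hull K) = Inf K"
proof (rule cInf_eq_minimum)
  show "Inf K \<in> convex hull K"
    using closed_contains_Inf[of K] assms hull_subset[of K convex]
    by (auto simp: compact_eq_bounded_closed bounded_imp_bdd_below)
next
  have "convex hull K \<subseteq> {Inf K..}"
    using assms by (intro hull_minimal)
      (auto intro!: cInf_lower simp: compact_eq_bounded_closed bounded_imp_bdd_below)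
  then show "Inf K \<le> x" if "x \<in> convex hull K" for x
    using that by auto
qed

lemma Sup_convex_hull:
  fixes K :: "real set"
  assumes "compact K" "K \<noteq> {}"
  shows "Sup (convex hull K) = Sup K"
proof (rule cSup_eq_maximum)
  show "Sup K \<in> convex hull K"
    using closed_contains_Sup[of K] assms hull_subset[of K convex]
    by (auto simp: compact_eq_bounded_closed bounded_imp_bdd_above)
next
  have "convex hull K \<subseteq> {..Sup K}"
    using assms by (intro hull_minimal)
      (auto intro!: cSup_upper simp: compact_eq_bounded_closed bounded_imp_bdd_above)
  then show "x \<le> Sup K" if "x \<in> convex hull K" for x
    using that by auto
qed

text \<open>
  In one dimension a separating hyperplane is a point, so disjoint intervals are ordered; the order
  survives in the closures, which is where the attractors live.
\<close>

lemma disjoint_convex_real_ordered: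
  fixes A B :: "real set"
  assumes "convex A" "convex B" "A \<noteq> {}" "B \<noteq> {}" "A \<inter> B = {}"
  shows "(\<forall>x\<in>closure A. \<forall>y\<in>closure B. x \<le> y) \<or> (\<forall>x\<in>closure A. \<forall>y\<in>closure B. y \<le> x)"
proof -
  obtain d b where d: "d \<noteq> 0" and A: "\<forall>x\<in>A. d * x \<le> b" and B: "\<forall>x\<in>B. d * x \<ge> b"
    using separating_hyperplane_sets[of A B] assms by auto
  show ?thesis
  proof (cases "d > 0")
    case True
    have "A \<subseteq> {..b/d}" "B \<subseteq> {b/d..}"
      using True A B by (auto simp: field_simps)
    then have "closure A \<subseteq> {..b/d}" "closure B \<subseteq> {b/d..}"
      by (simp_all add: closure_minimal)
    then show ?thesis by (meson atMost_iff atLeast_iff order_trans subsetD)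
  next
    case False
    with d have "d < 0" by simp
    then have "A \<subseteq> {b/d..}" "B \<subseteq> {..b/d}"
      using A B by (auto simp: field_simps)
    then have "closure A \<subseteq> {b/d..}" "closure B \<subseteq> {..b/d}"
      by (simp_all add: closure_minimal)
    then show ?thesis by (meson atMost_iff atLeast_iff order_trans subsetD)
  qed
qed

section \<open>Gaps of graph-directed attractors\<close>

text \<open>
  This form of the COSC serves both for graph-directed systems and, over a digraph with a single
  vertex, for standard systems, whose open set may be unbounded.
\<close>

locale ordered_gd_ifs = gd_ifs G \<rho>
  for G :: "('v, 'e) pre_digraph" and \<rho> +
  fixes c :: "'e \<Rightarrow> real" and F U :: "'v \<Rightarrow> real set"
  assumes attractors: "gd_attractors G \<rho> c F"
    and U_nonempty: "w \<in> verts G \<Longrightarrow> U w \<noteq> {}"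
    and U_convex: "w \<in> verts G \<Longrightarrow> convex (U w)"
    and U_invariant: "e \<in> arcs G \<Longrightarrow> gd_map \<rho> c e ` U (head G e) \<subseteq> U (tail G e)"
    and U_disjoint: "\<lbrakk>e \<in> arcs G; e' \<in> arcs G; tail G e = tail G e'; e \<noteq> e'\<rbrakk> \<Longrightarrow>
        gd_map \<rho> c e ` U (head G e) \<inter> gd_map \<rho> c e' ` U (head G e') = {}"
begin

definition piece :: "'e \<Rightarrow> real set" where
  "piece e = gd_map \<rho> c e ` F (head G e)"

definition cell :: "'e \<Rightarrow> real set" where
  "cell e = gd_map \<rho> c e ` U (head G e)"

lemma attractor_nonempty: "w \<in> verts G \<Longrightarrow> F w \<noteq> {}"
  and attractor_compact: "w \<in> verts G \<Longrightarrow> compact (F w)"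
  and attractor_eq: "w \<in> verts G \<Longrightarrow> F w = (\<Union>e\<in>out_arcs G w. piece e)"
  using attractors unfolding gd_attractors_def piece_def by blast+

lemma ratio_bounds: "e \<in> arcs G \<Longrightarrow> 0 < \<bar>\<rho> e\<bar>" "e \<in> arcs G \<Longrightarrow> \<bar>\<rho> e\<bar> < 1"
  "e \<in> arcs G \<Longrightarrow> \<rho> e \<noteq> 0"
  using ratio[of e] by auto

lemma dist_gd_map: "\<bar>gd_map \<rho> c e x - gd_map \<rho> c e y\<bar> = \<bar>\<rho> e\<bar> * \<bar>x - y\<bar>"
  by (simp add: gd_map_def abs_mult[symmetric] algebra_simps)

lemma piece_compact: "e \<in> arcs G \<Longrightarrow> compact (piece e)"
  unfolding piece_def gd_map_def
  by (intro compact_continuous_image continuous_intros attractor_compact) auto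

lemma piece_nonempty: "e \<in> arcs G \<Longrightarrow> piece e \<noteq> {}"
  by (simp add: piece_def attractor_nonempty)

lemma piece_subset: "e \<in> arcs G \<Longrightarrow> piece e \<subseteq> F (tail G e)"
  using attractor_eq[of "tail G e"] by (auto simp: out_arcs_def)

lemma piece_bounds:
  assumes "e \<in> arcs G"
  shows "Inf (piece e) \<in> piece e" "Sup (piece e) \<in> piece e"
    and "x \<in> piece e \<Longrightarrow> Inf (piece e) \<le> x" "x \<in> piece e \<Longrightarrow> x \<le> Sup (piece e)"
  using piece_compact[OF assms] piece_nonempty[OF assms]
  by (auto intro: closed_contains_Inf closed_contains_Sup cInf_lower cSup_upper
      simp: compact_eq_bounded_closed bounded_imp_bdd_below bounded_imp_bdd_above)

lemma basic_interval_bounds: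
  assumes "e \<in> arcs G"
  shows "Inf (basic_interval G \<rho> c F e) = Inf (piece e)"
    and "Sup (basic_interval G \<rho> c F e) = Sup (piece e)"
proof -
  have "gd_map \<rho> c e = (\<lambda>x. c e + \<rho> e *\<^sub>R x)"
    by (auto simp: gd_map_def)
  then have "basic_interval G \<rho> c F e = convex hull piece e"
    by (simp only: basic_interval_def piece_def convex_hull_affinity)
  then show "Inf (basic_interval G \<rho> c F e) = Inf (piece e)"
    "Sup (basic_interval G \<rho> c F e) = Sup (piece e)"
    using piece_compact[OF assms] piece_nonempty[OF assms]
    by (simp_all add: Inf_convex_hull Sup_convex_hull)
qed

text \<open>
  The greatest distance of a point of an attractor to its open set is at most a ratio times another
  such distance, because the maps send open sets into open sets; hence it vanishes.
\<close>

lemma attractor_subset_closure: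
  assumes w: "w \<in> verts G"
  shows "F w \<subseteq> closure (U w)"
proof -
  let ?X = "\<Union>w\<in>verts G. (\<lambda>y. infdist y (U w)) ` F w"
  have "compact ?X"
    by (intro compact_UN compact_continuous_image continuous_intros attractor_compact) auto
  moreover have "?X \<noteq> {}"
    using w attractor_nonempty by auto
  ultimately obtain D where D: "D \<in> ?X" "\<And>x. x \<in> ?X \<Longrightarrow> x \<le> D"
    using compact_attains_sup[of ?X] by blast
  obtain z y where z: "z \<in> verts G" and y: "y \<in> F z" "D = infdist y (U z)"
    using D(1) by auto
  obtain e y' where e: "e \<in> arcs G" "tail G e = z" and y': "y' \<in> F (head G e)"
      and yy': "y = gd_map \<rho> c e y'"
    using attractor_eq[OF z] y(1) by (auto simp: piece_def out_arcs_def)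
  have h: "head G e \<in> verts G"
    using e by simp
  have "D / \<bar>\<rho> e\<bar> \<le> dist y' x" if "x \<in> U (head G e)" for x
  proof -
    have "gd_map \<rho> c e x \<in> U z"
      using U_invariant[OF e(1)] that e(2) by auto
    then have "D \<le> dist y (gd_map \<rho> c e x)"
      using y(2) infdist_le by blast
    also have "\<dots> = \<bar>\<rho> e\<bar> * dist y' x"
      by (simp add: yy' dist_real_def dist_gd_map)
    finally show ?thesis
      using ratio_bounds(1)[OF e(1)] by (simp add: field_simps)
  qed
  then have "D / \<bar>\<rho> e\<bar> \<le> infdist y' (U (head G e))"
    using U_nonempty[OF h] unfolding infdist_notempty[OF U_nonempty[OF h]] by (intro cINF_greatest) auto
  also have "\<dots> \<le> D"
    using D(2) y' h by auto
  finally have "D \<le> D * \<bar>\<rho> e\<bar>"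
    using ratio_bounds(1)[OF e(1)] by (simp add: field_simps)
  then have "D * (1 - \<bar>\<rho> e\<bar>) \<le> 0"
    by (simp add: algebra_simps)
  then have "D \<le> 0"
    using ratio_bounds(2)[OF e(1)] by (simp add: mult_le_0_iff)
  show ?thesis
  proof
    fix x assume "x \<in> F w"
    then have "infdist x (U w) \<le> D"
      using D(2) w by blast
    then have "infdist x (U w) = 0"
      using \<open>D \<le> 0\<close> infdist_nonneg[of x "U w"] by linarith
    then show "x \<in> closure (U w)"
      using U_nonempty[OF w] by (simp add: in_closure_iff_infdist_zero)
  qed
qed

lemma piece_subset_closure_cell:
  assumes "e \<in> arcs G"
  shows "piece e \<subseteq> closure (cell e)"
proof -
  have "piece e \<subseteq> gd_map \<rho> c e ` closure (U (head G e))"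
    unfolding piece_def using assms by (intro image_mono attractor_subset_closure) auto
  also have "\<dots> \<subseteq> closure (cell e)"
    unfolding gd_map_def cell_def
    by (intro image_closure_subset continuous_intros closure_subset) auto
  finally show ?thesis .
qed

lemma cell_convex:
  assumes "e \<in> arcs G"
  shows "convex (cell e)"
proof -
  have "gd_map \<rho> c e = (\<lambda>x. c e + \<rho> e *\<^sub>R x)"
    by (auto simp: gd_map_def)
  moreover have "convex ((\<lambda>x. c e + \<rho> e *\<^sub>R x) ` U (head G e))"
    using assms by (intro convex_affinity U_convex head_in_verts)
  ultimately show ?thesis
    by (simp only: cell_def)
qed

lemma cells_ordered:
  assumes "e \<in> arcs G" "e' \<in> arcs G" "tail G e = tail G e'" "e \<noteq> e'"
  shows "(\<forall>x\<in>closure (cell e). \<forall>y\<in>closure (cell e'). x \<le> y) \<or>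
    (\<forall>x\<in>closure (cell e). \<forall>y\<in>closure (cell e'). y \<le> x)"
  using assms cell_convex U_disjoint[OF assms] U_nonempty
  by (intro disjoint_convex_real_ordered) (auto simp: cell_def)

lemma pieces_ordered:
  assumes "e \<in> arcs G" "e' \<in> arcs G" "tail G e = tail G e'" "e \<noteq> e'"
  shows "(\<forall>x\<in>piece e. \<forall>y\<in>piece e'. x \<le> y) \<or> (\<forall>x\<in>piece e. \<forall>y\<in>piece e'. y \<le> x)"
  using cells_ordered[OF assms] piece_subset_closure_cell[OF assms(1)]
    piece_subset_closure_cell[OF assms(2)] by blast

text \<open>
  A point of another piece strictly between two points of one piece would contradict the order
  of the pieces, so the maps send gaps to gaps.
\<close>

lemma gap_length_image:
  assumes e: "e \<in> arcs G" and l: "l \<in> gap_lengths (F (head G e))"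
  shows "\<bar>\<rho> e\<bar> * l \<in> gap_lengths (F (tail G e))"
proof -
  obtain a b where ab: "is_gap (F (head G e)) a b" "l = b - a"
    using l by (auto simp: gap_lengths_def)
  define s where "s = gd_map \<rho> c e a"
  define t where "t = gd_map \<rho> c e b"
  have st: "s \<in> piece e" "t \<in> piece e" "\<bar>t - s\<bar> = \<bar>\<rho> e\<bar> * l"
    using ab by (auto simp: s_def t_def piece_def is_gap_def dist_gd_map)
  have pos: "\<bar>\<rho> e\<bar> * l > 0"
    using ratio_bounds(1)[OF e] gap_length_pos[OF l] by simp
  have free: "y \<notin> {min s t<..<max s t}" if y: "y \<in> F (tail G e)" for y
  proof
    assume yst: "y \<in> {min s t<..<max s t}"
    obtain e' where e': "e' \<in> arcs G" "tail G e' = tail G e" "y \<in> piece e'"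
      using y attractor_eq[of "tail G e"] e by (auto simp: out_arcs_def)
    show False
    proof (cases "e' = e")
      case True
      then obtain x where x: "x \<in> F (head G e)" "y = gd_map \<rho> c e x"
        using e' by (auto simp: piece_def)
      have "x \<in> {a<..<b}"
        using yst x(2) ab ratio_bounds(3)[OF e]
        by (cases "\<rho> e > 0")
          (auto simp: s_def t_def gd_map_def is_gap_def min_def max_def mult_less_cancel_left
            split: if_splits)
      with x ab show False
        by (auto simp: is_gap_def)
    next
      case False
      then have "(y \<le> s \<and> y \<le> t) \<or> (s \<le> y \<and> t \<le> y)"
        using pieces_ordered[OF e'(1) e e'(2)] e'(3) st by blast
      with yst show False
        by (auto simp: min_def max_def split: if_splits)
    qed
  qed
  have "is_gap (F (tail G e)) (min s t) (max s t)"
    using st pos free piece_subset[OF e] by (auto simp: is_gap_def min_def max_def)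
  moreover have "max s t - min s t = \<bar>\<rho> e\<bar> * l"
    using st by linarith
  ultimately show ?thesis
    using gap_lengthsI by metis
qed

text \<open>
  Both endpoints lie in pieces.  If no piece contains both, the left endpoint ends its piece and the
  right one begins its own, since the order of the pieces leaves no room for more points.
\<close>

lemma gap_cases:
  assumes w: "w \<in> verts G" and g: "is_gap (F w) a b"
  obtains (image) e l where "e \<in> out_arcs G w" "l \<in> gap_lengths (F (head G e))"
      "b - a = \<bar>\<rho> e\<bar> * l"
  | (basic) e e' where "e \<in> out_arcs G w" "e' \<in> out_arcs G w" "a = Sup (piece e)"
      "b = Inf (piece e')" "\<And>d. d \<in> out_arcs G w \<Longrightarrow> \<not> (a \<in> piece d \<and> b \<in> piece d)"
proof (cases "\<exists>e\<in>out_arcs G w. a \<in> piece e \<and> b \<in> piece e")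
  case True
  then obtain e s t where e: "e \<in> arcs G" "tail G e = w"
    and s: "s \<in> F (head G e)" "a = gd_map \<rho> c e s"
    and t: "t \<in> F (head G e)" "b = gd_map \<rho> c e t"
    by (auto simp: piece_def out_arcs_def)
  have ab: "a < b"
    using g by (simp add: is_gap_def)
  have "x \<notin> {min s t<..<max s t}" if x: "x \<in> F (head G e)" for x
  proof
    assume xst: "x \<in> {min s t<..<max s t}"
    have "gd_map \<rho> c e x \<in> {a<..<b}"
      using xst ab s(2) t(2) ratio_bounds(3)[OF e(1)]
      by (cases "\<rho> e > 0")
        (auto simp: gd_map_def min_def max_def mult_less_cancel_left split: if_splits)
    moreover have "gd_map \<rho> c e x \<in> F w"
      using piece_subset[OF e(1)] x e(2) by (auto simp: piece_def)
    ultimately show False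
      using g by (auto simp: is_gap_def)
  qed
  moreover have "s \<noteq> t"
    using ab s t by auto
  ultimately have "is_gap (F (head G e)) (min s t) (max s t)"
    using s t by (auto simp: is_gap_def min_def max_def)
  moreover have "max s t - min s t = \<bar>t - s\<bar>"
    by linarith
  ultimately have "\<bar>t - s\<bar> \<in> gap_lengths (F (head G e))"
    using gap_lengthsI by metis
  moreover have "b - a = \<bar>\<rho> e\<bar> * \<bar>t - s\<bar>"
    using dist_gd_map[of e t s] ab s t by simp
  ultimately show ?thesis
    using image e by (auto simp: out_arcs_def)
next
  case False
  have ab: "a < b" "\<And>x. x \<in> F w \<Longrightarrow> x \<le> a \<or> b \<le> x"
    using g unfolding is_gap_def by (auto simp: disjoint_iff not_less)
  obtain e e' where e: "e \<in> arcs G" "tail G e = w" "a \<in> piece e"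
    and e': "e' \<in> arcs G" "tail G e' = w" "b \<in> piece e'"
    using g attractor_eq[OF w] by (auto simp: is_gap_def out_arcs_def)
  have notin: "b \<notin> piece e" "a \<notin> piece e'"
    using False e e' by (auto simp: out_arcs_def)
  then have "e \<noteq> e'"
    using e by auto
  then have ord: "\<forall>x\<in>piece e. \<forall>y\<in>piece e'. x \<le> y"
    using pieces_ordered[OF e(1) e'(1)] e e' ab(1) by (metis not_less)
  have "x \<le> a" if "x \<in> piece e" for x
    using ord that ab(2)[of x] piece_subset[OF e(1)] e notin e'(3) by (metis antisym subsetD)
  then have "a = Sup (piece e)"
    using piece_bounds[OF e(1)] e(3) by (simp add: antisym)
  moreover have "b \<le> x" if "x \<in> piece e'" for x
    using ord that ab(2)[of x] piece_subset[OF e'(1)] e' notin e(3) by (metis antisym subsetD)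
  then have "b = Inf (piece e')"
    using piece_bounds[OF e'(1)] e'(3) by (simp add: antisym)
  ultimately show ?thesis
    using basic[of e e'] e e' False by (auto simp: out_arcs_def)
qed

end

section \<open>Basic gaps along walks\<close>

text \<open>
  With at least two arcs leaving every vertex the attractors are not points.  Then the basic
  intervals at a vertex have distinct left endpoints, so that their ranking makes sense.
\<close>

locale branching_gd_ifs = ordered_gd_ifs +
  assumes outdeg: "w \<in> verts G \<Longrightarrow> out_degree G w \<ge> 2"
begin

lemma two_arcs:
  assumes "w \<in> verts G"
  obtains e e' where "e \<in> arcs G" "e' \<in> arcs G" "tail G e = w" "tail G e' = w" "e \<noteq> e'"
proof -
  have "\<not> card (out_arcs G w) \<le> Suc 0"
    using outdeg[OF assms] by (simp add: out_degree_def)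
  then show ?thesis
    using that card_le_Suc0_iff_eq[of "out_arcs G w"] by (auto simp: out_arcs_def)
qed

text \<open>
  The closures of two disjoint cells in \<open>U w\<close> contain the point \<open>q\<close>; so the
  convex set \<open>U w\<close> has points on either side of it.
\<close>

lemma singleton_attractor_in_open_set:
  assumes w: "w \<in> verts G" and q: "F w = {q}"
  shows "q \<in> U w"
proof -
  obtain e e' where e: "e \<in> arcs G" "e' \<in> arcs G" "tail G e = w" "tail G e' = w" "e \<noteq> e'"
    using two_arcs[OF w] .
  have "piece e = {q}" "piece e' = {q}"
    using piece_subset[of e] piece_nonempty[of e] piece_subset[of e'] piece_nonempty[of e'] e q
    by auto
  then have qcl: "q \<in> closure (cell e)" "q \<in> closure (cell e')"
    using piece_subset_closure_cell[of e] piece_subset_closure_cell[of e'] e by auto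
  obtain x y where xy: "x \<in> cell e" "y \<in> cell e'"
    using U_nonempty[of "head G e"] U_nonempty[of "head G e'"] e unfolding cell_def by auto
  then have "x \<in> U w" "y \<in> U w"
    using U_invariant[of e] U_invariant[of e'] e by (auto simp: cell_def)
  moreover have "x \<in> closure (cell e)" "y \<in> closure (cell e')"
    using xy closure_subset by blast+
  then have "x \<le> q \<and> q \<le> y \<or> y \<le> q \<and> q \<le> x"
    using cells_ordered[of e e'] e qcl by auto
  moreover have "is_interval (U w)"
    using U_convex[OF w] by (simp add: is_interval_convex_1)
  ultimately show ?thesis
    using mem_is_interval_1_I by metis
qed

text \<open>
  Otherwise two arcs leaving \<open>w\<close> end at vertices with one-point attractors, and these points lie in
  the open sets; their common image then lies in two disjoint cells.
\<close>

lemma attractor_nondegenerate: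
  assumes w: "w \<in> verts G"
  shows "F w \<noteq> {q}"
proof
  assume q: "F w = {q}"
  obtain e e' where e: "e \<in> arcs G" "e' \<in> arcs G" "tail G e = w" "tail G e' = w" "e \<noteq> e'"
    using two_arcs[OF w] .
  have "q \<in> cell a" if a: "a \<in> arcs G" "tail G a = w" for a
  proof -
    have img: "gd_map \<rho> c a x = q" if "x \<in> F (head G a)" for x
      using piece_subset[OF a(1)] a(2) q that by (auto simp: piece_def)
    obtain x where x: "x \<in> F (head G a)"
      using attractor_nonempty[of "head G a"] a by auto
    have "y = x" if "y \<in> F (head G a)" for y
    proof -
      have "\<rho> a * y = \<rho> a * x"
        using img[OF x] img[OF that] unfolding gd_map_def by linarith
      then show ?thesis
        using ratio_bounds(3)[OF a(1)] by simp
    qed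
    then have "F (head G a) = {x}"
      using x by blast
    then have "x \<in> U (head G a)"
      using singleton_attractor_in_open_set a by simp
    then show ?thesis
      using img[OF x] by (auto simp: cell_def)
  qed
  then show False
    using U_disjoint[of e e'] e by (auto simp: cell_def)
qed

lemma piece_nondegenerate:
  assumes e: "e \<in> arcs G"
  shows "Inf (piece e) < Sup (piece e)"
proof (rule ccontr)
  assume "\<not> Inf (piece e) < Sup (piece e)"
  then have *: "x = y" if "x \<in> piece e" "y \<in> piece e" for x y
    using piece_bounds(3,4)[OF e that(1)] piece_bounds(3,4)[OF e that(2)] by linarith
  obtain x where x: "x \<in> F (head G e)"
    using attractor_nonempty[of "head G e"] e by auto
  have "y = x" if "y \<in> F (head G e)" for y
  proof -
    have "gd_map \<rho> c e y = gd_map \<rho> c e x"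
      using * that x unfolding piece_def by blast
    then show ?thesis
      using ratio_bounds(3)[OF e] by (simp add: gd_map_def)
  qed
  then have "F (head G e) = {x}"
    using x by blast
  then show False
    using attractor_nondegenerate e by simp
qed

abbreviation ranked :: "'a \<Rightarrow> 'b list" where
  "ranked \<equiv> ranked_arcs G \<rho> c F"

abbreviation gap :: "'a \<Rightarrow> nat \<Rightarrow> real" where
  "gap \<equiv> basic_gap G \<rho> c F"

lemma inj_on_left_endpoint: "inj_on (\<lambda>e. Inf (basic_interval G \<rho> c F e)) (out_arcs G w)"
proof (rule inj_onI, rule ccontr)
  fix e e' assume e: "e \<in> out_arcs G w" "e' \<in> out_arcs G w" "e \<noteq> e'"
    and "Inf (basic_interval G \<rho> c F e) = Inf (basic_interval G \<rho> c F e')"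
  then have "Inf (piece e) = Inf (piece e')"
    by (simp add: basic_interval_bounds)
  moreover have "e \<in> arcs G" "e' \<in> arcs G" "tail G e = tail G e'"
    using e by (auto simp: out_arcs_def)
  ultimately show False
    using pieces_ordered[of e e'] e(3) piece_bounds(1,2)[of e] piece_bounds(1,2)[of e']
      piece_nondegenerate[of e] piece_nondegenerate[of e']
    by (metis not_le)
qed

lemma ranked_arcs:
  shows set_ranked: "set (ranked w) = out_arcs G w"
    and length_ranked: "length (ranked w) = out_degree G w"
    and strict_sorted_ranked:
      "sorted_wrt (<) (map (\<lambda>e. Inf (basic_interval G \<rho> c F e)) (ranked w))"
proof -
  show "set (ranked w) = out_arcs G w"
    unfolding ranked_arcs_def by (rule sorted_key_list_of_set_inj(1)[OF inj_on_left_endpoint])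
      (simp add: out_arcs_def)
  show "length (ranked w) = out_degree G w"
    unfolding ranked_arcs_def out_degree_def
    by (rule sorted_key_list_of_set_inj(2)[OF inj_on_left_endpoint])
      (simp add: out_arcs_def)
  show "sorted_wrt (<) (map (\<lambda>e. Inf (basic_interval G \<rho> c F e)) (ranked w))"
    unfolding ranked_arcs_def
    by (rule sorted_key_list_of_set_inj(3)[OF inj_on_left_endpoint])
      (simp add: out_arcs_def)
qed

lemma ranked_nth:
  assumes "i < out_degree G w"
  shows "ranked w ! i \<in> arcs G" "tail G (ranked w ! i) = w"
  using nth_mem[of i "ranked w"] assms by (simp_all add: set_ranked length_ranked)

lemma out_arc_ranked:
  assumes "e \<in> arcs G" "tail G e = w"
  obtains i where "i < out_degree G w" "e = ranked w ! i"
proof -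
  have "e \<in> set (ranked w)"
    using assms by (simp add: set_ranked)
  then show ?thesis
    using that by (auto simp: in_set_conv_nth length_ranked)
qed

lemma ranked_pieces_ordered:
  assumes ij: "i < j" "j < out_degree G w"
    and x: "x \<in> piece (ranked w ! i)" and y: "y \<in> piece (ranked w ! j)"
  shows "x \<le> y"
proof -
  let ?d = "ranked w ! i" and ?e = "ranked w ! j"
  have d: "?d \<in> arcs G" "tail G ?d = w" and e: "?e \<in> arcs G" "tail G ?e = w"
    using ij ranked_nth by auto
  have "Inf (basic_interval G \<rho> c F ?d) < Inf (basic_interval G \<rho> c F ?e)"
    using sorted_wrt_nth_less[OF strict_sorted_ranked, of i j w] ij by (simp add: length_ranked)
  then have less: "Inf (piece ?d) < Inf (piece ?e)"
    by (simp add: basic_interval_bounds d e)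
  then have "?d \<noteq> ?e"
    by auto
  then have "(\<forall>x\<in>piece ?d. \<forall>y\<in>piece ?e. x \<le> y) \<or> (\<forall>x\<in>piece ?d. \<forall>y\<in>piece ?e. y \<le> x)"
    using pieces_ordered[of ?d ?e] d e by simp
  then show ?thesis
    using x y less piece_bounds(1)[OF d(1)] piece_bounds(1)[OF e(1)] by (meson not_le)
qed

lemma gap_eq:
  assumes "k \<in> {1..out_degree G w - 1}"
  shows "gap w k = Inf (piece (ranked w ! k)) - Sup (piece (ranked w ! (k - 1)))"
proof -
  have "k < out_degree G w" "k - 1 < out_degree G w"
    using assms by auto
  then show ?thesis
    by (simp add: basic_gap_def basic_interval_bounds ranked_nth)
qed

lemma basic_gap_in_gap_lengths:
  assumes w: "w \<in> verts G" and k: "k \<in> {1..out_degree G w - 1}" and pos: "gap w k > 0"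
  shows "gap w k \<in> gap_lengths (F w)"
proof -
  let ?d = "ranked w ! (k - 1)" and ?e = "ranked w ! k"
  have kk: "k - 1 < k" "k < out_degree G w"
    using k by auto
  have d: "?d \<in> arcs G" "tail G ?d = w" and e: "?e \<in> arcs G" "tail G ?e = w"
    using ranked_nth kk by auto
  have free: "x \<le> Sup (piece ?d) \<or> Inf (piece ?e) \<le> x" if x: "x \<in> F w" for x
  proof -
    obtain a where a: "a \<in> arcs G" "tail G a = w" "x \<in> piece a"
      using x attractor_eq[OF w] by (auto simp: out_arcs_def)
    obtain j where j: "j < out_degree G w" "a = ranked w ! j"
      using out_arc_ranked[OF a(1,2)] .
    consider "j < k - 1" | "j = k - 1" | "j = k" | "k < j"
      using kk by linarith
    then show ?thesis
    proof cases
      case 1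
      then show ?thesis
        using ranked_pieces_ordered[of j "k - 1" w x] j a kk piece_bounds(2)[OF d(1)] by simp
    next
      case 2
      then show ?thesis
        using piece_bounds(4)[OF d(1)] a j by simp
    next
      case 3
      then show ?thesis
        using piece_bounds(3)[OF e(1)] a j by simp
    next
      case 4
      then show ?thesis
        using ranked_pieces_ordered[of k j w _ x] j a piece_bounds(1)[OF e(1)] by simp
    qed
  qed
  have "Sup (piece ?d) \<in> F w" "Inf (piece ?e) \<in> F w"
    using piece_bounds(2)[OF d(1)] piece_bounds(1)[OF e(1)]
      piece_subset[OF d(1)] piece_subset[OF e(1)] d(2) e(2) by auto
  moreover have "Sup (piece ?d) < Inf (piece ?e)"
    using pos gap_eq[OF k] by simp
  moreover have "F w \<inter> {Sup (piece ?d)<..<Inf (piece ?e)} = {}"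
    using free unfolding disjoint_iff greaterThanLessThan_iff by (meson not_le)
  ultimately have "is_gap (F w) (Sup (piece ?d)) (Inf (piece ?e))"
    by (simp add: is_gap_def)
  then show ?thesis
    using gap_lengthsI gap_eq[OF k] by metis
qed

text \<open>
  For a gap between two pieces the ranks are consecutive: a piece ranked between them would consist
  of endpoints of the gap only, and being nondegenerate it would contain both.
\<close>

lemma gap_length_cases:
  assumes w: "w \<in> verts G" and l: "l \<in> gap_lengths (F w)"
  obtains (basic) k where "k \<in> {1..out_degree G w - 1}" "l = gap w k"
  | (image) e l' where "e \<in> arcs G" "tail G e = w" "l' \<in> gap_lengths (F (head G e))"
      "l = \<bar>\<rho> e\<bar> * l'"
proof -
  obtain a b where ab: "is_gap (F w) a b" "l = b - a"
    using l by (auto simp: gap_lengths_def)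
  from w ab(1) show ?thesis
  proof (cases rule: gap_cases)
    case (image e l')
    then show ?thesis
      using that(2)[of e l'] ab(2) by simp
  next
    case (basic e e')
    have e: "e \<in> arcs G" "tail G e = w" and e': "e' \<in> arcs G" "tail G e' = w"
      using basic by auto
    obtain i where i: "i < out_degree G w" "e = ranked w ! i"
      using out_arc_ranked[OF e] .
    obtain j where j: "j < out_degree G w" "e' = ranked w ! j"
      using out_arc_ranked[OF e'] .
    have "a < b"
      using ab(1) by (simp add: is_gap_def)
    have aP: "a \<in> piece e" and bP: "b \<in> piece e'"
      using basic piece_bounds(1)[OF e'(1)] piece_bounds(2)[OF e(1)] by auto
    have "e \<noteq> e'"
      using basic(1,5) aP bP by blast
    then have "i \<noteq> j"
      using i j by auto
    moreover have "\<not> j < i"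
      using ranked_pieces_ordered[of j i w b a] i j aP bP \<open>a < b\<close> by auto
    ultimately have "i < j"
      by simp
    have "j = Suc i"
    proof (rule ccontr)
      assume "j \<noteq> Suc i"
      with \<open>i < j\<close> have lt: "i < Suc i" "Suc i < j" "Suc i < out_degree G w"
        using j by auto
      let ?m = "ranked w ! Suc i"
      have m: "?m \<in> arcs G" "tail G ?m = w"
        using ranked_nth lt by auto
      have m': "?m \<in> out_arcs G w"
        using m by simp
      have "x = a \<or> x = b" if "x \<in> piece ?m" for x
      proof -
        have "a \<le> x"
          using ranked_pieces_ordered[OF lt(1,3)] that aP i by blast
        moreover have "x \<le> b"
          using ranked_pieces_ordered[OF lt(2) j(1)] that bP j by blast
        moreover have "x \<in> F w"
          using piece_subset[OF m(1)] m that by auto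
        ultimately show ?thesis
          using ab(1) unfolding is_gap_def disjoint_iff greaterThanLessThan_iff
          by (metis antisym not_le)
      qed
      then have "a \<in> piece ?m \<and> b \<in> piece ?m"
        using piece_bounds(1,2)[OF m(1)] piece_nondegenerate[OF m(1)]
        by (metis less_irrefl)
      then show False
        using basic(5)[OF m'] by simp
    qed
    then have "j \<in> {1..out_degree G w - 1}" "j - 1 = i"
      using j by auto
    then show ?thesis
      using that(1)[of j] gap_eq[of j w] basic i j ab(2) by simp
  qed
qed

definition weight :: "'b list \<Rightarrow> real" where
  "weight p = (\<Prod>e\<leftarrow>p. \<bar>\<rho> e\<bar>)"

lemma weight_simps [simp]:
  "weight [] = 1" "weight (e # p) = \<bar>\<rho> e\<bar> * weight p" "weight (p @ q) = weight p * weight q"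
  by (simp_all add: weight_def)

lemma weight_pos: "set p \<subseteq> arcs G \<Longrightarrow> weight p > 0"
  using ratio_bounds(1) by (induction p) auto

lemma weight_less_one: "set p \<subseteq> arcs G \<Longrightarrow> p \<noteq> [] \<Longrightarrow> weight p < 1"
proof (induction p)
  case (Cons e p)
  then have e: "0 < \<bar>\<rho> e\<bar>" "\<bar>\<rho> e\<bar> < 1" and p: "weight p \<le> 1" "0 < weight p"
    using ratio_bounds[of e] weight_pos[of p] by (cases "p = []"; auto)+
  have "\<bar>\<rho> e\<bar> * weight p \<le> \<bar>\<rho> e\<bar> * 1"
    using p by (intro mult_left_mono) auto
  with e show ?case
    unfolding weight_simps by linarith
qed simp

lemma walk_gap_length:
  assumes "awalk w p z" "l \<in> gap_lengths (F z)"
  shows "weight p * l \<in> gap_lengths (F w)"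
  using assms
proof (induction p arbitrary: w)
  case (Cons e p)
  then have e: "e \<in> arcs G" "tail G e = w" "awalk (head G e) p z"
    by (auto simp: awalk_Cons_iff)
  then show ?case
    using gap_length_image[OF e(1) Cons.IH[OF e(3) Cons.prems(2)]] by (simp add: mult.assoc)
qed (simp add: awalk_Nil_iff)

lemma ratio_bound_uniform: "\<exists>r. 0 \<le> r \<and> r < 1 \<and> (\<forall>e\<in>arcs G. \<bar>\<rho> e\<bar> \<le> r)"
proof -
  let ?A = "insert 0 ((\<lambda>e. \<bar>\<rho> e\<bar>) ` arcs G)"
  have "Max ?A < 1"
    using ratio_bounds(2) by (subst Max_less_iff) auto
  moreover have "x \<le> Max ?A" if "x \<in> ?A" for x
    using that by (intro Max_ge) auto
  ultimately show ?thesis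
    by (intro exI[of _ "Max ?A"]) auto
qed

text \<open>
  Peeling off one arc at a time multiplies the gap length by at least the inverse of the largest
  ratio.  As the gap lengths are bounded, this ends at a basic gap.
\<close>

lemma gap_length_walk:
  assumes w: "w \<in> verts G" and l: "l \<in> gap_lengths (F w)"
  obtains p z k where "awalk w p z" "k \<in> {1..out_degree G z - 1}" "l = weight p * gap z k"
proof -
  have "bounded (\<Union>w\<in>verts G. F w)"
    using attractor_compact by (intro bounded_UN) (auto simp: compact_imp_bounded)
  then obtain B where B: "\<And>w x. \<lbrakk>w \<in> verts G; x \<in> F w\<rbrakk> \<Longrightarrow> \<bar>x\<bar> \<le> B"
    unfolding bounded_iff by auto
  have bound: "l \<le> 2 * B" if lw: "w \<in> verts G" "l \<in> gap_lengths (F w)" for l w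
  proof -
    obtain a b where "a \<in> F w" "b \<in> F w" "l = b - a"
      using lw by (auto simp: gap_lengths_def is_gap_def)
    then show ?thesis
      using B[OF lw(1), of a] B[OF lw(1), of b] by linarith
  qed
  obtain r where r: "0 \<le> r" "r < 1" "\<And>e. e \<in> arcs G \<Longrightarrow> \<bar>\<rho> e\<bar> \<le> r"
    using ratio_bound_uniform by blast
  have *: "\<exists>p z k. awalk w p z \<and> k \<in> {1..out_degree G z - 1} \<and> l = weight p * gap z k"
    if "w \<in> verts G" "l \<in> gap_lengths (F w)" "2 * B * r ^ n < l" for n w l
    using that
  proof (induction n arbitrary: w l)
    case 0
    then show ?case
      using bound[of w l] by simp
  next
    case (Suc n)
    from Suc.prems(1,2) show ?case
    proof (cases rule: gap_length_cases)
      case (basic k)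
      then show ?thesis
        using Suc.prems(1) by (intro exI[of _ "[]"] exI[of _ w] exI[of _ k])
          (simp add: awalk_Nil_iff)
    next
      case (image e l')
      have "r * (2 * B * r ^ n) < \<bar>\<rho> e\<bar> * l'"
        using Suc.prems(3) image(4) by (simp add: algebra_simps)
      also have "\<dots> \<le> r * l'"
        using r(3)[OF image(1)] gap_length_pos[OF image(3)] by (intro mult_right_mono) auto
      finally have "2 * B * r ^ n < l'"
        using r(1) by (simp only: mult_less_cancel_left)
      then obtain p z k where "awalk (head G e) p z" "k \<in> {1..out_degree G z - 1}"
          "l' = weight p * gap z k"
        using Suc.IH[of "head G e" l'] image by auto
      then show ?thesis
        using image by (intro exI[of _ "e # p"] exI[of _ z] exI[of _ k])
          (simp add: awalk_Cons_iff)
    qed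
  qed
  have "l > 0"
    using gap_length_pos[OF l] .
  have "0 < B"
    using bound[OF w l] \<open>l > 0\<close> by simp
  obtain n where "r ^ n < l / (2 * B)"
    using real_arch_pow_inv[of "l / (2 * B)" r] r \<open>l > 0\<close> \<open>0 < B\<close> by auto
  then have "2 * B * r ^ n < l"
    using \<open>0 < B\<close> by (simp add: field_simps)
  with *[OF w l] that show ?thesis
    by blast
qed

end

section \<open>Rational monomials in the contraction ratios\<close>

context gd_ifs
begin

definition monomial :: "('e \<Rightarrow> rat) \<Rightarrow> real" where
  "monomial m = (\<Prod>e\<in>arcs G. \<bar>\<rho> e\<bar> powr of_rat (m e))"

lemma monomial_pos: "monomial m > 0"
  unfolding monomial_def using ratio by (intro prod_pos) auto

lemma monomial_diff: "monomial (\<lambda>e. m e - n e) = monomial m / monomial n"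
  unfolding monomial_def by (simp add: of_rat_diff powr_diff prod_dividef)

lemma monomial_powr: "monomial m powr of_rat q = monomial (\<lambda>e. q * m e)"
proof -
  have "(\<Prod>e\<in>A. \<bar>\<rho> e\<bar> powr of_rat (m e)) powr of_rat q =
      (\<Prod>e\<in>A. \<bar>\<rho> e\<bar> powr of_rat (q * m e))" if "finite A" for A
    using that
    by induction (simp_all add: powr_mult prod_nonneg powr_powr of_rat_mult mult.commute)
  then show ?thesis
    by (simp add: monomial_def)
qed

lemma monomial_in_rat_powers:
  assumes inj: "inj_on (\<lambda>e. \<bar>\<rho> e\<bar>) (arcs G)" and e: "e \<in> arcs G" "m e \<noteq> 0"
  shows "monomial m \<in> rat_powers_star (abs_ratios G \<rho>)"
proof -
  \<comment> \<open>A rational power is indexed by the values of the ratios, a monomial by the arcs.\<close>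
  define m' where "m' = (\<lambda>x. m (the_inv_into (arcs G) (\<lambda>e. \<bar>\<rho> e\<bar>) x))"
  have m': "m' \<bar>\<rho> e\<bar> = m e" if "e \<in> arcs G" for e
    using the_inv_into_f_f[OF inj that] by (simp add: m'_def)
  have "monomial m = (\<Prod>a\<in>abs_ratios G \<rho>. a powr of_rat (m' a))"
    unfolding monomial_def abs_ratios_def prod.reindex[OF inj] using m' by simp
  moreover have "\<exists>a\<in>abs_ratios G \<rho>. m' a \<noteq> 0"
    using e m' by (auto simp: abs_ratios_def)
  ultimately show ?thesis
    unfolding rat_powers_star_def by blast
qed

end

section \<open>Independent gaps and ratios\<close>

locale independent_gd_ifs = branching_gd_ifs +
  assumes strong: "strongly_conn G"
    and ratios_inj: "inj_on (\<lambda>e. \<bar>\<rho> e\<bar>) (arcs G)"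
    and one_notin: "1 \<notin> rat_powers_star (abs_ratios G \<rho>)"
    and gaps_nonempty: "\<And>w. w \<in> verts G \<Longrightarrow> gap_set G \<rho> c F w \<noteq> {}"
    and gap_ratios: "\<And>w z k m. \<lbrakk>w \<in> verts G; z \<in> verts G;
           k \<in> {1..out_degree G w - 1}; m \<in> {1..out_degree G z - 1};
           (w, k) \<noteq> (z, m); basic_gap G \<rho> c F z m \<noteq> 0\<rbrakk>
         \<Longrightarrow> basic_gap G \<rho> c F w k / basic_gap G \<rho> c F z m \<notin> rat_powers (abs_ratios G \<rho>)"
begin

abbreviation gap_index :: "'a \<Rightarrow> nat \<Rightarrow> bool" where
  "gap_index z k \<equiv> z \<in> verts G \<and> k \<in> {1..out_degree G z - 1} \<and> gap z k > 0"

lemma positive_gap: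
  assumes "w \<in> verts G"
  obtains k where "gap_index w k"
proof -
  obtain k where "gap w k > 0" "k \<in> {1..out_degree G w - 1}"
    using gaps_nonempty[OF assms] unfolding gap_set_def by blast
  then show ?thesis
    using that assms by blast
qed

lemma monomial_eq_one:
  assumes "monomial m = 1" "e \<in> arcs G"
  shows "m e = 0"
  using monomial_in_rat_powers[OF ratios_inj assms(2), of m] assms(1) one_notin by metis

text \<open>
  The quotient of the two basic gaps is a rational monomial, so they are the same gap; then the
  quotient of the monomials is \<open>1\<close>, and multiplicative independence of the ratios identifies the
  exponents.
\<close>

lemma gap_representation_unique:
  assumes z: "gap_index z k" "gap_index z' k'"
    and eq: "monomial m * gap z k = monomial n * gap z' k'"
  shows "z = z' \<and> k = k' \<and> (\<forall>e\<in>arcs G. m e = n e)"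
proof -
  have q: "gap z k / gap z' k' = monomial (\<lambda>e. n e - m e)"
    using eq z monomial_pos[of m] by (simp add: monomial_diff field_simps)
  have "monomial l \<in> rat_powers (abs_ratios G \<rho>)" for l
  proof (cases "\<exists>e\<in>arcs G. l e \<noteq> 0")
    case True
    then show ?thesis
      using monomial_in_rat_powers[OF ratios_inj] by (auto simp: rat_powers_def)
  next
    case False
    then have "monomial l = 1"
      using ratio by (simp add: monomial_def)
    then show ?thesis
      by (simp add: rat_powers_def)
  qed
  then have zz: "z = z'" "k = k'"
    using gap_ratios[of z z' k k'] z q by auto
  then have "monomial (\<lambda>e. n e - m e) = 1"
    using q z by simp
  then show ?thesis
    using monomial_eq_one[of "\<lambda>e. n e - m e"] zz by auto
qed

lemma weight_eq_monomial:
  assumes "set p \<subseteq> arcs G"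
  shows "weight p = monomial (\<lambda>e. of_nat (count_list p e))"
  using assms
proof (induction p)
  case Nil
  show ?case
    using ratio by (simp add: monomial_def)
next
  case (Cons e p)
  have "monomial (\<lambda>a. of_nat (count_list (e # p) a)) =
      (\<Prod>a\<in>arcs G. (if a = e then \<bar>\<rho> a\<bar> else 1) * \<bar>\<rho> a\<bar> powr of_rat (of_nat (count_list p a)))"
    unfolding monomial_def
  proof (rule prod.cong[OF refl])
    fix a assume "a \<in> arcs G"
    then have "0 < \<bar>\<rho> a\<bar>"
      by (rule ratio_bounds)
    then show "\<bar>\<rho> a\<bar> powr of_rat (of_nat (count_list (e # p) a)) =
        (if a = e then \<bar>\<rho> a\<bar> else 1) * \<bar>\<rho> a\<bar> powr of_rat (of_nat (count_list p a))"
      by (auto simp: powr_add)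
  qed
  also have "\<dots> = \<bar>\<rho> e\<bar> * monomial (\<lambda>a. of_nat (count_list p a))"
    using Cons.prems by (simp add: prod.distrib prod.delta monomial_def)
  finally show ?case
    using Cons by simp
qed

lemma walk_arcs: "awalk w p z \<Longrightarrow> set p \<subseteq> arcs G \<and> w \<in> verts G \<and> z \<in> verts G"
  using awalk_hd_in_verts[of w p z] awalk_last_in_verts[of w p z] unfolding awalk_def by blast

lemma gap_length_positive_walk:
  assumes "w \<in> verts G" "l \<in> gap_lengths (F w)"
  obtains p z k where "awalk w p z" "gap_index z k" "l = weight p * gap z k"
proof -
  obtain p z k where p: "awalk w p z" "k \<in> {1..out_degree G z - 1}" "l = weight p * gap z k"
    using gap_length_walk[OF assms] .
  then have "gap z k > 0"
    using gap_length_pos[OF assms(2)] walk_arcs[OF p(1)] weight_pos[of p]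
    by (simp add: zero_less_mult_iff)
  then show ?thesis
    using that p walk_arcs by blast
qed

lemma walk_gap_in_gap_lengths:
  assumes "awalk w p z" "gap_index z k"
  shows "weight p * gap z k \<in> gap_lengths (F w)"
  by (rule walk_gap_length[OF assms(1) basic_gap_in_gap_lengths]) (use assms(2) in blast)+

text \<open>
  Let \<open>\<lambda>\<close> be a basic gap at \<open>u\<close>.  Among the gaps \<open>r\<^sup>n * \<lambda>\<close> two come from the same
  basic gap, whence a power of \<open>r\<close>, and so \<open>r\<close> itself, is a rational monomial.  By independence
  the gap \<open>r * \<lambda>\<close> can only be a copy of \<open>\<lambda>\<close>.
\<close>

lemma self_similarity_ratio_is_closed_walk_weight:
  assumes u: "u \<in> verts G" and r: "0 < r" "r < 1"
    and self: "\<And>l. l \<in> gap_lengths (F u) \<Longrightarrow> r * l \<in> gap_lengths (F u)"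
  obtains q where "awalk u q u" "q \<noteq> []" "r = weight q"
proof -
  obtain k0 where k0: "gap_index u k0"
    using positive_gap[OF u] .
  let ?g = "gap u k0"
  have pow: "r ^ n * ?g \<in> gap_lengths (F u)" for n
    by (induction n) (use self k0 basic_gap_in_gap_lengths in \<open>auto simp: mult.assoc\<close>)
  have "\<exists>q x. awalk u q (fst x) \<and> gap_index (fst x) (snd x) \<and>
      r ^ n * ?g = weight q * gap (fst x) (snd x)" for n
    using gap_length_positive_walk[OF u pow[of n]] by (metis fst_conv snd_conv)
  then obtain q x where qx: "\<And>n. awalk u (q n) (fst (x n))"
      "\<And>n. gap_index (fst (x n)) (snd (x n))"
      "\<And>n. r ^ n * ?g = weight (q n) * gap (fst (x n)) (snd (x n))"
    by metis
  have "range x \<subseteq> Sigma (verts G) (\<lambda>z. {1..out_degree G z - 1})"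
    using qx(2) by (auto simp: mem_Sigma_iff subset_iff) (metis fst_conv snd_conv)+
  then have "finite (range x)"
    by (rule finite_subset) auto
  then have "\<not> inj x"
    using finite_imageD by fastforce
  then obtain i j where ij: "i < j" "x i = x j"
    unfolding inj_def by (metis linorder_neqE_nat)
  define n where "n = j - i"
  have n: "n > 0" "j = n + i"
    using ij by (auto simp: n_def)
  define M where "M = (\<lambda>e. rat_of_nat (count_list (q j) e) - rat_of_nat (count_list (q i) e))"
  let ?h = "gap (fst (x i)) (snd (x i))"
  have wpos: "weight (q i) > 0" for i
    using weight_pos walk_arcs[OF qx(1)] by blast
  have "r ^ j * ?g / (r ^ i * ?g) = weight (q j) * ?h / (weight (q i) * ?h)"
    using qx(3)[of i] qx(3)[of j] ij(2) by simp
  then have "r ^ n = weight (q j) / weight (q i)"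
    using k0 r qx(2)[of i] by (simp add: n power_add)
  also have "\<dots> = monomial M"
    using walk_arcs[OF qx(1)] by (simp add: M_def monomial_diff weight_eq_monomial)
  finally have "r ^ n = monomial M" .
  then have "r = monomial M powr of_rat (1 / of_nat n)"
  proof -
    have "monomial M powr of_rat (1 / of_nat n) = (r powr real n) powr (1 / real n)"
      using \<open>r ^ n = monomial M\<close> r by (simp add: powr_realpow of_rat_divide)
    then show ?thesis
      using r n(1) by (simp add: powr_powr)
  qed
  then have rM: "r = monomial (\<lambda>e. 1 / of_nat n * M e)"
    by (simp only: monomial_powr)
  obtain p z k where p: "awalk u p z" "gap_index z k" "r * ?g = weight p * gap z k"
    using gap_length_positive_walk[OF u self[OF basic_gap_in_gap_lengths]] k0 by metis
  then have "z = u \<and> k = k0"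
    using gap_representation_unique[OF k0 p(2)] rM walk_arcs[OF p(1)]
    by (metis weight_eq_monomial)
  then have "awalk u p u" "r = weight p"
    using p k0 by auto
  moreover have "p \<noteq> []"
    using r \<open>r = weight p\<close> by auto
  ultimately show ?thesis
    using that by blast
qed

text \<open>
  Expressed by the multiplicities of the arcs, because these are what a gap length determines.
\<close>

definition departures :: "'a \<Rightarrow> 'b list \<Rightarrow> nat" where
  "departures u p = (\<Sum>e\<in>out_arcs G u. count_list p e)"

lemma departures_append: "departures u (p @ q) = departures u p + departures u q"
  by (simp add: departures_def sum.distrib)

lemma departures_closed_walk:
  assumes "awalk u q u" "q \<noteq> []"
  shows "departures u q \<ge> 1"
proof -
  obtain e p where q: "q = e # p"
    using assms(2) by (cases q) auto
  have e: "e \<in> out_arcs G u"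
    using assms(1) by (simp add: q awalk_Cons_iff)
  have "count_list q e \<le> departures u q"
    unfolding departures_def by (rule member_le_sum[OF e]) auto
  then show ?thesis
    by (simp add: q)
qed

text \<open>
  Here \<open>B\<close> and \<open>R\<close> stand for the basic gap lengths and the absolute ratios of a standard system with
  attractor \<open>F u\<close>.  Pulling a gap back along one of its maps strips the weight of a closed walk at
  \<open>u\<close>.  By uniqueness of the representation this removes at least one departure, so the number of
  departures bounds the number of maps that lead from a basic gap of the standard system to the gap.
\<close>

lemma finite_gap_lengths_bounded_departures:
  assumes u: "u \<in> verts G"
    and B: "finite B" and R: "finite R"
    and r: "\<forall>r\<in>R. 0 < r \<and> r < 1 \<and> (\<forall>l\<in>gap_lengths (F u). r * l \<in> gap_lengths (F u))"
    and gen: "\<forall>l\<in>gap_lengths (F u). l \<in> B \<or> (\<exists>r\<in>R. \<exists>l'\<in>gap_lengths (F u). l = r * l')"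
  shows "finite {weight q * gap z k |q z k. awalk u q z \<and> gap_index z k \<and> departures u q < N}"
    (is "finite (?S N)")
proof (induction N)
  case (Suc N)
  have "?S (Suc N) \<subseteq> B \<union> (\<lambda>(r, l). r * l) ` (R \<times> ?S N)"
  proof
    fix l assume "l \<in> ?S (Suc N)"
    then obtain q z k where q: "awalk u q z" "gap_index z k" "departures u q < Suc N"
        "l = weight q * gap z k"
      by auto
    then have "l \<in> gap_lengths (F u)"
      using walk_gap_in_gap_lengths by simp
    with gen have "l \<in> B \<or> (\<exists>r\<in>R. \<exists>l'\<in>gap_lengths (F u). l = r * l')"
      by blast
    then show "l \<in> B \<union> (\<lambda>(r, l). r * l) ` (R \<times> ?S N)"
    proof
      assume "\<exists>r\<in>R. \<exists>l'\<in>gap_lengths (F u). l = r * l'"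
      then obtain r l' where r': "r \<in> R" and l': "l' \<in> gap_lengths (F u)" "l = r * l'"
        by blast
      obtain a where a: "awalk u a u" "a \<noteq> []" "r = weight a"
        using self_similarity_ratio_is_closed_walk_weight[OF u, of r] r r' by metis
      obtain p y i where p: "awalk u p y" "gap_index y i" "l' = weight p * gap y i"
        using gap_length_positive_walk[OF u l'(1)] .
      have ap: "set (a @ p) \<subseteq> arcs G" "set q \<subseteq> arcs G"
        using walk_arcs a(1) p(1) q(1) by auto
      have "weight q * gap z k = weight (a @ p) * gap y i"
        using q(4) l'(2) a(3) p(3) by simp
      then have "\<forall>e\<in>arcs G. rat_of_nat (count_list q e) = rat_of_nat (count_list (a @ p) e)"
        using gap_representation_unique[OF q(2) p(2), of "\<lambda>e. rat_of_nat (count_list q e)"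
            "\<lambda>e. rat_of_nat (count_list (a @ p) e)"] weight_eq_monomial[OF ap(1)]
          weight_eq_monomial[OF ap(2)] by simp
      then have "\<forall>e\<in>arcs G. count_list q e = count_list (a @ p) e"
        by (simp only: of_nat_eq_iff)
      then have "departures u q = departures u (a @ p)"
        unfolding departures_def by (intro sum.cong) auto
      also have "\<dots> \<ge> 1 + departures u p"
        using departures_closed_walk[OF a(1,2)] by (simp add: departures_append)
      finally have "departures u p < N"
        using q(3) by simp
      then have "l' \<in> ?S N"
        using p by blast
      then show ?thesis
        using r' l'(2) by force
    qed simp
  qed
  then show ?case
    by (rule finite_subset) (use B R Suc in auto)
qed simp

text \<open>
  A walk to the circuit followed by any number of rounds departs from \<open>u\<close> only before reaching the
  circuit, while every round makes the gap shorter.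
\<close>

lemma infinite_gap_lengths_bounded_departures:
  assumes u: "u \<in> verts G" and circuit: "circuit_avoiding G u"
  obtains N where "infinite {weight q * gap z k |q z k.
    awalk u q z \<and> gap_index z k \<and> departures u q < N}"
proof -
  obtain v C where C: "awalk v C v" "C \<noteq> []" "u \<notin> set (awalk_verts v C)"
    using circuit by (auto simp: circuit_avoiding_def directed_path_def)
  have v: "v \<in> verts G"
    using walk_arcs[OF C(1)] by simp
  obtain p where p: "awalk u p v"
    using strong u v by (auto simp: strongly_conn_def directed_path_def)
  obtain k where k: "gap_index v k"
    using positive_gap[OF v] .
  define q where "q n = p @ concat (replicate n C)" for n
  have loop: "awalk v (concat (replicate n C)) v" for n
    by (induction n) (use C(1) v in \<open>auto simp: awalk_Nil_iff intro: awalk_appendI\<close>)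
  have q: "awalk u (q n) v" for n
    using awalk_appendI[OF p loop[of n]] by (simp only: q_def)
  have "e \<notin> set C" if "e \<in> out_arcs G u" for e
  proof
    assume "e \<in> set C"
    then have "tail G e \<in> set (awalk_verts v C)"
      using C(1) set_awalk_verts[OF C(1)] by auto
    then show False
      using that C(3) by auto
  qed
  then have "departures u C = 0"
    by (simp add: departures_def)
  moreover have "departures u [] = 0"
    by (simp add: departures_def)
  ultimately have "departures u (concat (replicate n C)) = 0" for n
    by (induction n) (simp_all add: departures_append)
  then have dep: "departures u (q n) = departures u p" for n
    by (simp add: q_def departures_append)
  have wC: "0 < weight C" "weight C < 1" and wp: "0 < weight p"
    using weight_pos weight_less_one C(1,2) p walk_arcs by auto
  have "weight (concat (replicate n C)) = weight C ^ n" for n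
    by (induction n) simp_all
  then have wq: "weight (q n) * gap v k = weight p * gap v k * weight C ^ n" for n
    by (simp add: q_def)
  have "inj (\<lambda>n. weight (q n) * gap v k)"
  proof (rule injI)
    fix i j assume "weight (q i) * gap v k = weight (q j) * gap v k"
    then have "weight C ^ i = weight C ^ j"
      using wp k by (simp add: wq)
    then show "i = j"
      using wC by (metis less_irrefl linorder_neqE_nat power_strict_decreasing)
  qed
  then have "infinite (range (\<lambda>n. weight (q n) * gap v k))"
    by (simp add: range_inj_infinite)
  moreover have "range (\<lambda>n. weight (q n) * gap v k) \<subseteq> {weight q * gap z k |q z k.
      awalk u q z \<and> gap_index z k \<and> departures u q < Suc (departures u p)}"
    using q k dep by (auto intro!: exI)
  ultimately show ?thesis
    using that infinite_super by blast
qed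

end

section \<open>Standard systems as one-vertex graph-directed systems\<close>

text \<open>
  The set \<open>R\<close> consists of the absolute contraction ratios.  The set \<open>B\<close> contains the gap lengths
  between two images of the attractor; it is finite because a pair of images determines the gap.
\<close>

lemma standard_ifs_gap_structure:
  assumes ifs: "standard_ifs I" and cosc: "ifs_cosc I" and attr: "ifs_attractor I K"
  obtains R B where "finite R" "finite B"
    "\<forall>r\<in>R. 0 < r \<and> r < 1 \<and> (\<forall>l\<in>gap_lengths K. r * l \<in> gap_lengths K)"
    "\<forall>l\<in>gap_lengths K. l \<in> B \<or> (\<exists>r\<in>R. \<exists>l'\<in>gap_lengths K. l = r * l')"
proof -
  define H :: "(unit, real \<Rightarrow> real) pre_digraph" where
    "H = \<lparr>verts = {()}, arcs = I, tail = (\<lambda>_. ()), head = (\<lambda>_. ())\<rparr>"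
  \<comment> \<open>The arcs are the maps themselves, so their coefficients are recovered from values.\<close>
  define slope where "slope f = f 1 - f 0" for f :: "real \<Rightarrow> real"
  define offset where "offset f = f 0" for f :: "real \<Rightarrow> real"
  have H: "verts H = {()}" "arcs H = I" "tail H f = ()" "head H f = ()" "out_arcs H w = I" for f w
    by (auto simp: H_def out_arcs_def)
  have finI: "finite I"
    using ifs by (simp add: standard_ifs_def)
  have f: "slope f \<in> {-1<..<1} - {0}" "gd_map slope offset f = f" if fI: "f \<in> I" for f
  proof -
    obtain r s where "r \<in> {-1<..<1} - {0}" "f = (\<lambda>t. r * t + s)"
      using ifs fI unfolding standard_ifs_def by blast
    then show "slope f \<in> {-1<..<1} - {0}" "gd_map slope offset f = f"
      by (auto simp: slope_def offset_def gd_map_def algebra_simps)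
  qed
  obtain U where U: "U \<noteq> {}" "convex U" "(\<Union>f\<in>I. f ` U) \<subseteq> U"
      "disjoint_family_on (\<lambda>f. f ` U) I"
    using cosc by (auto simp: ifs_cosc_def)
  interpret H: ordered_gd_ifs H slope offset "\<lambda>_. K" "\<lambda>_. U"
  proof
    show "gd_attractors H slope offset (\<lambda>_. K)"
      using attr f(2) by (simp add: gd_attractors_def ifs_attractor_def H cong: SUP_cong)
    show "gd_map slope offset e ` U \<inter> gd_map slope offset e' ` U = {}"
      if "e \<in> arcs H" "e' \<in> arcs H" "e \<noteq> e'" for e e'
      using that U(4) f(2) unfolding disjoint_family_on_def by (simp add: H)
    show "gd_map slope offset e ` U \<subseteq> U" if "e \<in> arcs H" for e
      using that U(3) f(2) by (auto simp: H)
  qed (use finI f U in \<open>auto simp: H\<close>)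
  let ?R = "(\<lambda>f. \<bar>slope f\<bar>) ` I"
  let ?B = "(\<lambda>(f, g). Inf (H.piece g) - Sup (H.piece f)) ` (I \<times> I)"
  show ?thesis
  proof (rule that[of ?R ?B])
    show "\<forall>r\<in>?R. 0 < r \<and> r < 1 \<and> (\<forall>l\<in>gap_lengths K. r * l \<in> gap_lengths K)"
      using H.gap_length_image H.ratio_bounds by (auto simp: H)
    show "\<forall>l\<in>gap_lengths K. l \<in> ?B \<or> (\<exists>r\<in>?R. \<exists>l'\<in>gap_lengths K. l = r * l')"
    proof
      fix l assume l: "l \<in> gap_lengths K"
      obtain a b where ab: "is_gap K a b" "l = b - a"
        using l by (auto simp: gap_lengths_def)
      have "() \<in> verts H"
        by (simp add: H)
      from this ab(1) show "l \<in> ?B \<or> (\<exists>r\<in>?R. \<exists>l'\<in>gap_lengths K. l = r * l')"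
      proof (cases rule: H.gap_cases)
        case (image f l')
        then show ?thesis
          using ab(2) by (auto simp: H)
      next
        case (basic f g)
        then have "f \<in> I" "g \<in> I"
          by (simp_all add: H)
        then show ?thesis
          using basic ab(2) by force
      qed
    qed
  qed (use finI in auto)
qed

theorem lemma4p4:
  fixes G :: "('v, 'e) pre_digraph"
    and \<rho> c :: "'e \<Rightarrow> real"
    and F :: "'v \<Rightarrow> real set"
    and u :: 'v
  assumes ifs: "gd_ifs G \<rho>"
    and strong: "strongly_conn G"
    and outdeg: "\<And>w. w \<in> verts G \<Longrightarrow> out_degree G w \<ge> 2"
    and cosc: "gd_cosc G \<rho> c"
    and attractors: "gd_attractors G \<rho> c F"
    and ratios_inj: "inj_on (\<lambda>e. \<bar>\<rho> e\<bar>) (arcs G)"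
    and one_notin: "1 \<notin> rat_powers_star (abs_ratios G \<rho>)"
    and gaps_nonempty: "\<And>w. w \<in> verts G \<Longrightarrow> gap_set G \<rho> c F w \<noteq> {}"
    and gap_ratios: "\<And>w z k m. \<lbrakk>w \<in> verts G; z \<in> verts G;
           k \<in> {1..out_degree G w - 1}; m \<in> {1..out_degree G z - 1};
           (w, k) \<noteq> (z, m); basic_gap G \<rho> c F z m \<noteq> 0\<rbrakk>
         \<Longrightarrow> basic_gap G \<rho> c F w k / basic_gap G \<rho> c F z m \<notin> rat_powers (abs_ratios G \<rho>)"
    and vertex: "u \<in> verts G"
    and circuit: "circuit_avoiding G u"
  shows "\<not> (\<exists>I. standard_ifs I \<and> ifs_cosc I \<and> ifs_attractor I (F u))"
proof
  assume "\<exists>I. standard_ifs I \<and> ifs_cosc I \<and> ifs_attractor I (F u)"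
  then obtain I where I: "standard_ifs I" "ifs_cosc I" "ifs_attractor I (F u)"
    by blast
  interpret gd_ifs G \<rho>
    by (rule ifs)
  obtain U where U: "\<forall>u\<in>verts G. U u \<noteq> {} \<and> bounded (U u) \<and> convex (U u) \<and> open (U u) \<and>
      (\<Union>e\<in>out_arcs G u. gd_map \<rho> c e ` U (head G e)) \<subseteq> U u \<and>
      disjoint_family_on (\<lambda>e. gd_map \<rho> c e ` U (head G e)) (out_arcs G u)"
    using cosc unfolding gd_cosc_def by (rule exE)
  interpret ordered_gd_ifs G \<rho> c F U
  proof
    show "gd_map \<rho> c e ` U (head G e) \<subseteq> U (tail G e)" if e: "e \<in> arcs G" for e
    proof -
      have "(\<Union>a\<in>out_arcs G (tail G e). gd_map \<rho> c a ` U (head G a)) \<subseteq> U (tail G e)"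
        using U e by simp
      then show ?thesis
        using e by (simp add: UN_subset_iff)
    qed
    show "gd_map \<rho> c e ` U (head G e) \<inter> gd_map \<rho> c e' ` U (head G e') = {}"
      if e: "e \<in> arcs G" "e' \<in> arcs G" "tail G e = tail G e'" "e \<noteq> e'" for e e'
    proof -
      have "disjoint_family_on (\<lambda>e. gd_map \<rho> c e ` U (head G e)) (out_arcs G (tail G e))"
        using U e(1) by simp
      then show ?thesis
        using e unfolding disjoint_family_on_def by simp
    qed
  qed (use U attractors in simp_all)
  interpret independent_gd_ifs G \<rho> c F U
    by unfold_locales (fact outdeg strong ratios_inj one_notin gaps_nonempty gap_ratios)+
  obtain R B where "finite R" "finite B"
    "\<forall>r\<in>R. 0 < r \<and> r < 1 \<and> (\<forall>l\<in>gap_lengths (F u). r * l \<in> gap_lengths (F u))"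
    "\<forall>l\<in>gap_lengths (F u). l \<in> B \<or> (\<exists>r\<in>R. \<exists>l'\<in>gap_lengths (F u). l = r * l')"
    using standard_ifs_gap_structure[OF I] .
  then have "finite {weight q * gap z k |q z k. awalk u q z \<and> gap_index z k \<and> departures u q < N}"
    for N
    using finite_gap_lengths_bounded_departures[OF vertex, of B R N] by blast
  then show False
    using infinite_gap_lengths_bounded_departures[OF vertex circuit] by blast
qed

end
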